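(* Let $S_1$ and $S_2$ be Puiseux monoids. The reduced finitary power monoids $\mathcal P_{\mathrm{fin},0}(S_1)$ and $\mathcal P_{\mathrm{fin},0}(S_2)$ are isomorphic (as monoids) if and only if $S_1$ and $S_2$ are isomorphic (as monoids).
   Context: A Puiseux monoid is a subset $S$ of the non-negative rational numbers $\mathbb Q_{\ge 0}$ that contains $0$ and is closed under addition; it is regarded as a monoid under addition. For a Puiseux monoid $S$, the reduced finitary power monoid $\mathcal P_{\mathrm{fin},0}(S)$ is the monoid whose elements are the finite subsets of $S$ containing $0$, with operation the set addition $X + Y := \{x + y : x \in X,\ y \in Y\}$ and identity $\{0\}$. Isomorphisms are monoid isomorphisms. *)

theory Defs
  imports Complex_Main "HOL-Algebra.Group" "HOL-Library.Set_Algebras"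
begin

definition puiseux_monoid :: "rat set \<Rightarrow> bool" where
  "puiseux_monoid S \<longleftrightarrow>
     S \<subseteq> {0..} \<and> 0 \<in> S \<and> (\<forall>x\<in>S. \<forall>y\<in>S. x + y \<in> S)"

definition additive_monoid :: "rat set \<Rightarrow> rat monoid" where
  "additive_monoid S = \<lparr>carrier = S, monoid.mult = (+), one = 0\<rparr>"

(* The multiplication is the elementwise sum X + Y = {x + y | x \<in> X, y \<in> Y}
   provided by HOL-Library.Set_Algebras. *)
definition power_monoid_fin0 :: "rat set \<Rightarrow> rat set monoid" where
  "power_monoid_fin0 S =
     \<lparr>carrier = {X. finite X \<and> X \<subseteq> S \<and> 0 \<in> X}, monoid.mult = (+), one = {0}\<rparr>"

lemma additive_monoid_comm_monoid:
  assumes "puiseux_monoid S"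
  shows "comm_monoid (additive_monoid S)"
  using assms unfolding puiseux_monoid_def additive_monoid_def
  by (intro comm_monoidI) (auto simp: add_ac)

lemma power_monoid_fin0_comm_monoid:
  assumes "puiseux_monoid S"
  shows "comm_monoid (power_monoid_fin0 S)"
proof -
  have "0 \<in> X + Y" if "0 \<in> X" "0 \<in> Y" for X Y :: "rat set"
    using set_plus_intro[OF that] by simp
  moreover have "X + Y \<subseteq> S" if "X \<subseteq> S" "Y \<subseteq> S" for X Y
    using assms that unfolding puiseux_monoid_def set_plus_def by blast
  moreover have "{0} + X = X" for X :: "rat set"
    by (auto simp: set_plus_def)
  moreover have "0 \<in> S"
    using assms by (simp add: puiseux_monoid_def)
  ultimately show ?thesis
    unfolding power_monoid_fin0_def
    by (intro comm_monoidI) (simp_all add: finite_set_plus add.assoc, rule add.commute)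
qed

(* The library's hom (hence iso) does not ask that the identity be preserved;
   for an isomorphism between monoids this is automatic. *)
lemma iso_preserves_one:
  assumes "monoid G" "monoid H" "h \<in> Group.iso G H"
  shows "h \<one>\<^bsub>G\<^esub> = \<one>\<^bsub>H\<^esub>"
proof -
  interpret G: monoid G by fact
  interpret H: monoid H by fact
  have hom: "h \<in> hom G H" and surj: "h ` carrier G = carrier H"
    using assms(3) by (auto simp: Group.iso_def bij_betw_def)
  obtain x where x: "x \<in> carrier G" "h x = \<one>\<^bsub>H\<^esub>"
    using surj H.one_closed by (metis imageE)
  have "h \<one>\<^bsub>G\<^esub> = h \<one>\<^bsub>G\<^esub> \<otimes>\<^bsub>H\<^esub> h x"
    using x hom by (simp add: hom_in_carrier)
  also have "\<dots> = h x"
    using hom_mult[OF hom G.one_closed x(1)] x(1) by simp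
  finally show ?thesis using x by simp
qed

end

theory Submission
  imports Defs "HOL-Library.Multiset"
begin

text \<open>
  An isomorphism of monoids induces an isomorphism of their power monoids by taking images; the
  substance is in the other direction, which recovers the monoid \<open>S\<close> from its power monoid by
  looking at maxima. Taking the maximum turns sums of sets into sums of numbers, but it is not
  clear that an isomorphism \<open>F\<close> between power monoids respects it. The bridge is an equation in which
  the maximum of \<open>X\<close> appears in terms that \<open>F\<close> respects: if \<open>a\<close> is the maximum of \<open>X\<close>, then
  \<open>(k + 1)X = kX + {0, a}\<close> for some \<open>k\<close> (lemma \<open>nfold_Suc_eq_plus_Max\<close>). This holds because any
  \<open>x \<in> X\<close> is commensurable with \<open>a\<close>, so that sufficiently many copies of \<open>x\<close> can be traded
  for copies of \<open>0\<close> and \<open>a\<close> without changing their sum or their number.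

  Applying \<open>F\<close> to this equation and comparing maxima, which can be cancelled, gives
  \<open>max F(X) = max F({0, max X})\<close>: the maximum of \<open>F(X)\<close> depends on the maximum of \<open>X\<close> only.
  Hence \<open>\<phi>(a) = max F({0, a})\<close> is additive, since \<open>{0, a} + {0, b}\<close> has maximum \<open>a + b\<close>, and
  the same construction applied to the inverse of \<open>F\<close> yields the inverse of \<open>\<phi>\<close>.
\<close>

section \<open>Iterated sumsets\<close>

primrec nfold :: "nat \<Rightarrow> 'a::comm_monoid_add set \<Rightarrow> 'a set" where
  "nfold 0 X = {0}"
| "nfold (Suc k) X = nfold k X + X"

lemma nfold_add: "nfold (m + n) X = nfold m X + nfold n X"
  by (induction n) (auto simp: add.assoc simp flip: set_zero)

lemma nfold_mono: "X \<subseteq> Y \<Longrightarrow> nfold k X \<subseteq> nfold k Y"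
  by (induction k) (simp_all add: set_plus_mono2)

lemma nfold_conv_mset:
  "nfold k X = {sum_mset M | M. size M = k \<and> set_mset M \<subseteq> X}"
proof (induction k)
  case (Suc k)
  show ?case
  proof (intro equalityI subsetI)
    fix z assume "z \<in> nfold (Suc k) X"
    then obtain M x where "size M = k" "set_mset M \<subseteq> X" "x \<in> X" "z = sum_mset M + x"
      unfolding nfold.simps Suc.IH by (auto elim!: set_plus_elim)
    then show "z \<in> {sum_mset M | M. size M = Suc k \<and> set_mset M \<subseteq> X}"
      by (auto intro!: exI[of _ "add_mset x M"] simp: add.commute)
  next
    fix z assume "z \<in> {sum_mset M | M. size M = Suc k \<and> set_mset M \<subseteq> X}"
    then obtain M where M: "size M = Suc k" "set_mset M \<subseteq> X" "z = sum_mset M" by blast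
    then obtain x M' where "M = add_mset x M'" by (metis size_eq_Suc_imp_eq_union)
    with M have "sum_mset M' \<in> nfold k X" "x \<in> X" "z = sum_mset M' + x"
      unfolding Suc.IH by (auto simp: add.commute)
    then show "z \<in> nfold (Suc k) X" by (auto intro: set_plus_intro)
  qed
qed auto

lemma scaled_mem_nfold_pair:
  fixes a :: "'a::comm_semiring_1"
  assumes "m \<le> n"
  shows "of_nat m * a \<in> nfold n {0, a}"
  unfolding nfold_conv_mset using assms
  by (auto intro!: exI[of _ "replicate_mset m a + replicate_mset (n - m) 0"]
           split: if_splits)

lemma nfold_closed:
  assumes "puiseux_monoid S" "X \<in> carrier (power_monoid_fin0 S)"
  shows "nfold k X \<in> carrier (power_monoid_fin0 S)"
proof -
  interpret comm_monoid "power_monoid_fin0 S"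
    using assms(1) by (rule power_monoid_fin0_comm_monoid)
  show ?thesis
    using assms(2) m_closed one_closed
    by (induction k) (simp_all add: power_monoid_fin0_def)
qed

section \<open>Splitting off the maximum\<close>

text \<open>Rationality enters here: any two positive rationals have a common positive integer multiple.\<close>

lemma rat_commensurable:
  fixes x a :: rat
  assumes "0 \<le> x" "x \<le> a"
  obtains m n :: nat where "0 < n" "m \<le> n" "of_nat n * x = of_nat m * a"
proof (cases "a = 0")
  case True
  with assms show ?thesis by (intro that[of 1 0]) auto
next
  case False
  obtain p q where pq: "quotient_of (x / a) = (p, q)" by fastforce
  then have q: "q > 0" and eq: "x / a = of_int p / of_int q"
    by (auto simp: quotient_of_denom_pos quotient_of_div)
  have "0 \<le> x / a" "x / a \<le> 1" using assms False by (auto simp: field_simps)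
  with q have p: "0 \<le> p" "p \<le> q" by (auto simp: eq field_simps)
  have "of_int q * x = of_int p * a" using eq q False by (simp add: field_simps)
  then show ?thesis using p q by (intro that[of "nat q" "nat p"]) auto
qed

text \<open>
  By commensurability, every \<open>x \<in> X\<close> has some \<open>n x > 0\<close> such that \<open>n x\<close> copies of \<open>x\<close> have the same
  sum as \<open>n x\<close> summands from \<open>{0, Max X}\<close>. A sum of more than \<open>\<Sum>x\<in>X. n x\<close> elements of \<open>X\<close>
  contains such a block by the pigeonhole principle; once the block is replaced, one of the new
  summands can be split off.
\<close>

lemma nfold_Suc_eq_plus_Max:
  fixes X :: "rat set"
  assumes fin: "finite X" and "0 \<in> X" and nonneg: "X \<subseteq> {0..}"
  obtains k where "nfold (Suc k) X = nfold k X + {0, Max X}"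
proof -
  define a where "a = Max X"
  have a: "a \<in> X" using assms Max_in a_def by blast
  have "\<exists>n>0. of_nat n * x \<in> nfold n {0, a}" if "x \<in> X" for x
  proof -
    have "0 \<le> x" "x \<le> a" using that nonneg fin by (auto simp: a_def)
    then obtain m n :: nat where "0 < n" "m \<le> n" "of_nat n * x = of_nat m * a"
      by (rule rat_commensurable)
    then show ?thesis using scaled_mem_nfold_pair[of m n a] by auto
  qed
  then obtain n where n: "\<And>x. x \<in> X \<Longrightarrow> 0 < n x \<and> of_nat (n x) * x \<in> nfold (n x) {0, a}"
    by metis
  define k where "k = (\<Sum>x\<in>X. n x)"
  have "z \<in> nfold k X + {0, a}" if "z \<in> nfold (Suc k) X" for z
  proof -
    from that obtain M where M: "size M = Suc k" "set_mset M \<subseteq> X" "z = sum_mset M"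
      unfolding nfold_conv_mset by blast
    have "\<exists>x\<in>X. n x \<le> count M x"
    proof (rule ccontr)
      assume *: "\<not> ?thesis"
      have "size M = (\<Sum>x\<in>set_mset M. count M x)" by (simp add: size_multiset_overloaded_eq)
      also have "\<dots> \<le> (\<Sum>x\<in>X. count M x)" using fin M(2) by (intro sum_mono2) auto
      also have "\<dots> \<le> k" unfolding k_def using * by (intro sum_mono) auto
      finally show False using M(1) by simp
    qed
    then obtain x where x: "x \<in> X" "n x \<le> count M x" by blast
    define M' where "M' = M - replicate_mset (n x) x"
    have "replicate_mset (n x) x \<subseteq># M" using x(2) by (simp add: count_le_replicate_mset_subset_eq)
    then have M': "M = M' + replicate_mset (n x) x" by (simp add: M'_def)
    have size: "Suc k = size M' + n x" using M(1) M' by simp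
    obtain j where j: "n x = Suc j" using n[OF x(1)] gr0_implies_Suc by blast
    have "sum_mset M' \<in> nfold (size M') X"
      using M(2) M' unfolding nfold_conv_mset by auto
    moreover have "of_nat (n x) * x \<in> nfold (Suc j) {0, a}" using n[OF x(1)] j by metis
    moreover have "z = sum_mset M' + of_nat (n x) * x" using M(3) M' by simp
    ultimately have "z \<in> nfold (size M') X + nfold (Suc j) {0, a}"
      by (metis set_plus_intro)
    also have "\<dots> \<subseteq> nfold (size M') X + nfold j X + {0, a}"
      using nfold_mono[of "{0, a}" X j] a assms(2)
      by (simp add: add.assoc set_plus_mono2)
    also have "\<dots> = nfold k X + {0, a}" using size j by (simp flip: nfold_add)
    finally show ?thesis .
  qed
  moreover have "nfold k X + {0, a} \<subseteq> nfold (Suc k) X"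
    using a assms(2) by (simp add: set_plus_mono2)
  ultimately show thesis using that[of k] a_def by blast
qed

lemma Max_set_plus:
  fixes X Y :: "'a::linordered_ab_group_add set"
  assumes "finite X" "X \<noteq> {}" "finite Y" "Y \<noteq> {}"
  shows "Max (X + Y) = Max X + Max Y"
proof (rule Max_eqI)
  show "finite (X + Y)" using assms by (simp add: finite_set_plus)
  show "Max X + Max Y \<in> X + Y" using assms by (intro set_plus_intro) auto
  fix z assume "z \<in> X + Y"
  then show "z \<le> Max X + Max Y" using assms by (auto elim!: set_plus_elim intro!: add_mono)
qed

section \<open>Homomorphisms of power monoids and maxima\<close>

lemma hom_nfold:
  assumes "puiseux_monoid S" and F: "F \<in> hom (power_monoid_fin0 S) (power_monoid_fin0 T)"
    and one: "F {0} = {0}" and X: "X \<in> carrier (power_monoid_fin0 S)"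
  shows "F (nfold k X) = nfold k (F X)"
proof (induction k)
  case (Suc k)
  then show ?case
    using hom_mult[OF F nfold_closed[OF assms(1) X, of k] X] by (simp add: power_monoid_fin0_def)
qed (simp add: one)

text \<open>
  Apply \<open>F\<close> to \<open>(k + 1)X = kX + {0, max X}\<close>, take maxima, and cancel the maximum of \<open>k F(X)\<close>.
\<close>

lemma Max_hom_eq:
  assumes S: "puiseux_monoid S" and T: "puiseux_monoid T"
    and F: "F \<in> hom (power_monoid_fin0 S) (power_monoid_fin0 T)" and one: "F {0} = {0}"
    and X: "X \<in> carrier (power_monoid_fin0 S)"
  shows "Max (F X) = Max (F {0, Max X})"
proof -
  have X': "finite X" "0 \<in> X" "X \<subseteq> S" using X by (auto simp: power_monoid_fin0_def)
  moreover have "X \<subseteq> {0..}" using S X'(3) by (auto simp: puiseux_monoid_def)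
  ultimately obtain k where k: "nfold (Suc k) X = nfold k X + {0, Max X}"
    using nfold_Suc_eq_plus_Max by blast
  have "Max X \<in> X" using X' by (auto intro!: Max_in)
  with X' have U: "{0, Max X} \<in> carrier (power_monoid_fin0 S)"
    by (auto simp: power_monoid_fin0_def)
  have FX: "F X \<in> carrier (power_monoid_fin0 T)" and FU: "F {0, Max X} \<in> carrier (power_monoid_fin0 T)"
    using F X U by (auto intro: hom_in_carrier)
  note FkX = nfold_closed[OF T FX, of k]
  have "nfold k (F X) + F X = F (nfold (Suc k) X)"
    using hom_nfold[OF S F one X, of "Suc k"] by simp
  also have "\<dots> = nfold k (F X) + F {0, Max X}"
    unfolding k using hom_mult[OF F nfold_closed[OF S X, of k] U] hom_nfold[OF S F one X, of k]
    by (simp add: power_monoid_fin0_def)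
  finally have "Max (nfold k (F X) + F X) = Max (nfold k (F X) + F {0, Max X})" by simp
  moreover have "Max (nfold k (F X) + Y) = Max (nfold k (F X)) + Max Y"
    if "Y \<in> carrier (power_monoid_fin0 T)" for Y
    using that FkX by (intro Max_set_plus) (auto simp: power_monoid_fin0_def)
  ultimately show ?thesis using FX FU by simp
qed

lemma iso_imp_iso_power_monoid_fin0:
  assumes S: "puiseux_monoid S" and T: "puiseux_monoid T"
    and h: "h \<in> Group.iso (additive_monoid S) (additive_monoid T)"
  shows "image h \<in> Group.iso (power_monoid_fin0 S) (power_monoid_fin0 T)"
proof -
  have h0: "h 0 = 0"
    using iso_preserves_one[OF _ _ h] additive_monoid_comm_monoid[OF S]
      additive_monoid_comm_monoid[OF T]
    by (auto simp: additive_monoid_def comm_monoid_def)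
  have hadd: "h (x + y) = h x + h y" if "x \<in> S" "y \<in> S" for x y
    using h that by (auto simp: Group.iso_def hom_def additive_monoid_def)
  have inj: "inj_on h S" and surj: "h ` S = T"
    using h by (auto simp: Group.iso_def bij_betw_def additive_monoid_def)
  have plus: "h ` (X + Y) = h ` X + h ` Y" if "X \<subseteq> S" "Y \<subseteq> S" for X Y
  proof -
    have "h ` (X + Y) = (\<lambda>(x, y). h (x + y)) ` (X \<times> Y)"
      by (simp add: set_plus_image image_image case_prod_unfold)
    also have "\<dots> = (\<lambda>(x, y). h x + h y) ` (X \<times> Y)"
      using that by (intro image_cong) (auto intro!: hadd)
    also have "\<dots> = (\<lambda>(u, v). u + v) ` map_prod h h ` (X \<times> Y)"
      by (simp add: image_image case_prod_unfold)
    also have "\<dots> = h ` X + h ` Y"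
      by (simp add: set_plus_image case_prod_unfold map_prod_surj_on[OF refl refl])
    finally show ?thesis .
  qed
  have "inj_on (image h) (carrier (power_monoid_fin0 S))"
    using inj by (auto intro!: inj_onI simp: power_monoid_fin0_def inj_on_image_eq_iff)
  moreover have "Y \<in> image h ` carrier (power_monoid_fin0 S)"
    if "Y \<in> carrier (power_monoid_fin0 T)" for Y
  proof -
    let ?X = "inv_into S h ` Y"
    have Y: "finite Y" "Y \<subseteq> T" "0 \<in> Y" using that by (auto simp: power_monoid_fin0_def)
    have "0 \<in> S" using S by (simp add: puiseux_monoid_def)
    then have "0 = inv_into S h 0" using inj h0 by (metis inv_into_f_f)
    then have "0 \<in> ?X" using Y(3) by blast
    moreover have "?X \<subseteq> S" using Y(2) surj by (auto intro: inv_into_into)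
    ultimately have "?X \<in> carrier (power_monoid_fin0 S)"
      using Y(1) by (simp add: power_monoid_fin0_def)
    moreover have "h ` ?X = Y" using Y(2) surj by (simp add: image_inv_into_cancel)
    ultimately show ?thesis by blast
  qed
  moreover have "h ` X \<in> carrier (power_monoid_fin0 T)"
    if "X \<in> carrier (power_monoid_fin0 S)" for X
    using that h0 surj by (force simp: power_monoid_fin0_def)
  moreover have "h ` (X + Y) = h ` X + h ` Y"
    if "X \<in> carrier (power_monoid_fin0 S)" "Y \<in> carrier (power_monoid_fin0 S)" for X Y
    using that plus by (simp add: power_monoid_fin0_def)
  ultimately show ?thesis
    by (auto simp: Group.iso_def hom_def bij_betw_def power_monoid_fin0_def)
qed

lemma (in monoid) inv_into_iso:
  assumes h: "h \<in> Group.iso G H"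
  shows "inv_into (carrier G) h \<in> Group.iso H G"
proof -
  have hom: "h \<in> hom G H" and bij: "bij_betw h (carrier G) (carrier H)"
    using h by (auto simp: Group.iso_def)
  let ?g = "inv_into (carrier G) h"
  have bij': "bij_betw ?g (carrier H) (carrier G)" using bij by (rule bij_betw_inv_into)
  have "?g (x \<otimes>\<^bsub>H\<^esub> y) = ?g x \<otimes> ?g y" if xy: "x \<in> carrier H" "y \<in> carrier H" for x y
  proof -
    have g: "?g x \<in> carrier G" "?g y \<in> carrier G" using bij' xy by (auto dest: bij_betwE)
    then have "h (?g x \<otimes> ?g y) = x \<otimes>\<^bsub>H\<^esub> y"
      using hom_mult[OF hom g] xy bij by (simp add: bij_betw_inv_into_right)
    then show ?thesis using g bij by (metis bij_betw_inv_into_left m_closed)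
  qed
  then show ?thesis using bij' by (auto simp: Group.iso_def hom_def dest: bij_betwE)
qed

lemma iso_power_monoid_fin0_imp_iso:
  assumes S: "puiseux_monoid S" and T: "puiseux_monoid T"
    and F: "F \<in> Group.iso (power_monoid_fin0 S) (power_monoid_fin0 T)"
  shows "(\<lambda>a. Max (F {0, a})) \<in> Group.iso (additive_monoid S) (additive_monoid T)"
proof -
  let ?P = "power_monoid_fin0 S" and ?Q = "power_monoid_fin0 T"
  interpret P: comm_monoid ?P using S by (rule power_monoid_fin0_comm_monoid)
  interpret Q: comm_monoid ?Q using T by (rule power_monoid_fin0_comm_monoid)
  define G where "G = inv_into (carrier ?P) F"
  have G: "G \<in> Group.iso ?Q ?P" unfolding G_def using F by (rule P.inv_into_iso)
  have Fhom: "F \<in> hom ?P ?Q" and Ghom: "G \<in> hom ?Q ?P" using F G by (auto simp: Group.iso_def)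
  have GF: "G (F X) = X" if "X \<in> carrier ?P" for X
    using F that by (auto simp: G_def Group.iso_def bij_betw_def)
  have FG: "F (G Y) = Y" if "Y \<in> carrier ?Q" for Y
    using F that by (auto simp: G_def Group.iso_def bij_betw_def f_inv_into_f)
  have F0: "F {0} = {0}" and G0: "G {0} = {0}"
    using iso_preserves_one[OF P.monoid_axioms Q.monoid_axioms F]
      iso_preserves_one[OF Q.monoid_axioms P.monoid_axioms G]
    by (auto simp: power_monoid_fin0_def)
  have pair: "{0, a} \<in> carrier (power_monoid_fin0 R) \<and> Max {0, a} = a"
    if "puiseux_monoid R" "a \<in> R" for a R
    using that by (auto simp: power_monoid_fin0_def puiseux_monoid_def max_def)
  have Max_mem: "Max X \<in> R" if "X \<in> carrier (power_monoid_fin0 R)" for X R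
    using that Max_in[of X] by (auto simp: power_monoid_fin0_def simp del: Max_in)
  have FS: "F {0, a} \<in> carrier ?Q" if "a \<in> S" for a
    using Fhom pair[OF S that] by (auto intro: hom_in_carrier)
  have GT: "G {0, b} \<in> carrier ?P" if "b \<in> T" for b
    using Ghom pair[OF T that] by (auto intro: hom_in_carrier)
  note FMax = Max_hom_eq[OF S T Fhom F0] and GMax = Max_hom_eq[OF T S Ghom G0]
  have "bij_betw (\<lambda>a. Max (F {0, a})) S T"
  proof (rule bij_betw_byWitness[where f' = "\<lambda>b. Max (G {0, b})"])
    show "\<forall>a\<in>S. Max (G {0, Max (F {0, a})}) = a"
      using GMax[OF FS] GF pair[OF S] by auto
    show "\<forall>b\<in>T. Max (F {0, Max (G {0, b})}) = b"
      using FMax[OF GT] FG pair[OF T] by auto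
    show "(\<lambda>a. Max (F {0, a})) ` S \<subseteq> T" using Max_mem FS by blast
    show "(\<lambda>b. Max (G {0, b})) ` T \<subseteq> S" using Max_mem GT by blast
  qed
  moreover have "Max (F {0, a + b}) = Max (F {0, a}) + Max (F {0, b})" if "a \<in> S" "b \<in> S" for a b
  proof -
    note ab = pair[OF S that(1)] pair[OF S that(2)]
    have "Max ({0, a} + {0, b}) = Max {0, a} + Max {0, b}" by (rule Max_set_plus) auto
    then have "Max ({0, a} + {0, b}) = a + b" using ab by simp
    moreover have "{0, a} + {0, b} \<in> carrier ?P"
      using P.m_closed ab by (auto simp: power_monoid_fin0_def)
    ultimately have "Max (F {0, a + b}) = Max (F ({0, a} + {0, b}))" using FMax by metis
    also have "F ({0, a} + {0, b}) = F {0, a} + F {0, b}"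
      using hom_mult[OF Fhom] ab by (simp add: power_monoid_fin0_def)
    also have "Max \<dots> = Max (F {0, a}) + Max (F {0, b})"
      using FS[OF that(1)] FS[OF that(2)]
      by (intro Max_set_plus) (auto simp: power_monoid_fin0_def)
    finally show ?thesis .
  qed
  ultimately show ?thesis
    by (auto simp: Group.iso_def hom_def additive_monoid_def bij_betw_def)
qed

theorem theorem2p5:
  fixes S\<^sub>1 S\<^sub>2 :: "rat set"
  assumes "puiseux_monoid S\<^sub>1" and "puiseux_monoid S\<^sub>2"
  shows "power_monoid_fin0 S\<^sub>1 \<cong> power_monoid_fin0 S\<^sub>2 \<longleftrightarrow>
         additive_monoid S\<^sub>1 \<cong> additive_monoid S\<^sub>2"
  using iso_power_monoid_fin0_imp_iso[OF assms] iso_imp_iso_power_monoid_fin0[OF assms]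
  unfolding is_iso_def by blast

end
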